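(* Let $f\in C^{1,1}_{loc}(\mathbb R^n,\mathbb R)$. Suppose that $f$ attains its minimum value $f^\star>-\infty$, that its minimizer $x^\star$ is unique, and that there is $\mu_f>0$ such that for all $x\in\mathbb R^n$ $$\tfrac12\|\nabla f(x)\|^2\ \ge\ \mu_f\,(f(x)-f^\star).$$ Let $c_1,c_2>0$, $p_1>2$, $1<p_2<2$. Then the trajectories of $$\dot x=-c_1\frac{\nabla f(x)}{\|\nabla f(x)\|^{\frac{p_1-2}{p_1-1}}}-c_2\frac{\nabla f(x)}{\|\nabla f(x)\|^{\frac{p_2-2}{p_2-1}}}$$ converge to the optimal point $x^\star$ in fixed time for all $x(0)\in\mathbb R^n$; that is, there exists $\bar T<\infty$, independent of $x(0)$, such that every trajectory satisfies $x(t)=x^\star$ for all $t\ge\bar T$.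
   Context: $\|\cdot\|$ is the Euclidean norm. $C^{1,1}_{loc}(\mathbb R^n,\mathbb R)$ is the set of continuously differentiable functions with locally Lipschitz continuous gradient. Convention: the right-hand side of the differential equation is defined to be $0$ at points where $\nabla f(x)=0$. A trajectory is a solution $t\mapsto x(t)$, $t\ge 0$, of the differential equation. The function $f$ is not assumed convex. *)

theory Defs
  imports "HOL-Analysis.Analysis"
begin

definition grad :: "('a::real_inner \<Rightarrow> real) \<Rightarrow> 'a \<Rightarrow> 'a" where
  "grad f x = (THE D. GDERIV f x :> D)"

lemma grad_eqI:
  assumes "GDERIV f x :> D"
  shows "grad f x = D"
  unfolding grad_def
proof (rule the_equality)
  show "GDERIV f x :> D" by (fact assms)
next
  fix E assume "GDERIV f x :> E"
  with assms have "(\<lambda>h. inner h D) = (\<lambda>h. inner h E)"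
    unfolding gderiv_def by (rule has_derivative_unique)
  then have "inner (E - D) D = inner (E - D) E" by (rule fun_cong)
  then have "inner (E - D) (E - D) = 0" by (simp add: inner_diff_right)
  then show "E = D" by simp
qed

text \<open>Differentiability is stated through the existence of a gradient vector, so that
  \<^const>\<open>grad\<close> is never the unspecified value of a definite description under
  this hypothesis. \<close>

definition C11_loc :: "('a::real_inner \<Rightarrow> real) \<Rightarrow> bool" where
  "C11_loc f \<longleftrightarrow>
     (\<forall>x. \<exists>D. GDERIV f x :> D) \<and>
     continuous_on UNIV (grad f) \<and>
     (\<forall>x. \<exists>u>0. \<exists>L. L-lipschitz_on (cball x u) (grad f))"

definition flow_rhs ::
  "real \<Rightarrow> real \<Rightarrow> real \<Rightarrow> real \<Rightarrow> ('a::real_inner \<Rightarrow> real) \<Rightarrow> 'a \<Rightarrow> 'a" where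
  "flow_rhs c1 c2 p1 p2 f x =
     (if grad f x = 0 then 0
      else - (c1 *\<^sub>R (grad f x /\<^sub>R norm (grad f x) powr ((p1 - 2) / (p1 - 1))))
           - (c2 *\<^sub>R (grad f x /\<^sub>R norm (grad f x) powr ((p2 - 2) / (p2 - 1)))))"

text \<open>A classical solution on \<open>[0, \<infinity>)\<close>, with the one-sided derivative at \<open>0\<close>.
  The values of \<open>x\<close> at negative times are irrelevant.\<close>

definition is_trajectory ::
  "('a::real_normed_vector \<Rightarrow> 'a) \<Rightarrow> (real \<Rightarrow> 'a) \<Rightarrow> bool" where
  "is_trajectory F x \<longleftrightarrow>
     (\<forall>t\<ge>0. (x has_vector_derivative F (x t)) (at t within {0..}))"

end

theory Submission
  imports Defs
begin

text \<open>
  Along a trajectory the optimality gap \<open>V t = f (x t) - fstar\<close> has derivative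
  \<open>- c1 g\<^bsup>q1\<^esup> - c2 g\<^bsup>q2\<^esup>\<close>, where \<open>g\<close> is the norm of the gradient at \<open>x t\<close> and
  \<open>qi = pi / (pi - 1)\<close> is the conjugate exponent of \<open>pi\<close>. The gradient dominance inequality
  \<open>g\<^sup>2 \<ge> 2 \<mu> V\<close> turns this into \<open>V' \<le> - A V\<^bsup>\<alpha>\<^esup> - B V\<^bsup>\<beta>\<^esup>\<close> with \<open>\<alpha> = q1 / 2\<close>, \<open>\<beta> = q2 / 2\<close>, and
  the assumptions on \<open>p1\<close>, \<open>p2\<close> give \<open>\<alpha> < 1 < \<beta>\<close>. The \<open>\<beta>\<close>-term brings \<open>V\<close> down
  from arbitrarily large values to \<open>1\<close> within a bounded time, and the \<open>\<alpha>\<close>-term brings it from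
  \<open>1\<close> down to \<open>0\<close> within a bounded time.

  Both phases are handled at once by the bounded change of variable
  \<open>v \<mapsto> v\<^bsup>r\<^esup> / (1 + v\<^bsup>r\<^esup>)\<close> with \<open>r = min (1 - \<alpha>) (\<beta> - 1)\<close>: while \<open>V\<close> is positive, the image of
  \<open>V\<close> lies strictly between \<open>0\<close> and \<open>1\<close> and decreases with speed at least \<open>r min A B / 4\<close>
  (lemma \<open>bounded_rescaling_speed\<close>). Hence \<open>V\<close> vanishes from the time
  \<open>4 / (r min A B)\<close> on, whatever its initial value (lemma \<open>fixed_time_vanishing\<close>), and
  \<open>V t = 0\<close> means \<open>x t = xstar\<close> by uniqueness of the minimizer.\<close>

text \<open>For \<open>v \<le> 1\<close> the term \<open>v\<^bsup>\<alpha>\<^esup>\<close> alone gives the bound, because \<open>r \<le> 1 - \<alpha>\<close> and the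
  denominator is at most \<open>4\<close>; for \<open>v \<ge> 1\<close> the term \<open>v\<^bsup>\<beta>\<^esup>\<close> alone does, because
  \<open>r \<le> \<beta> - 1\<close> and the denominator is at most \<open>4 v\<^bsup>2r\<^esup>\<close>. The factor multiplying the sum is
  the derivative of \<open>v \<mapsto> v\<^bsup>r\<^esup> / (1 + v\<^bsup>r\<^esup>)\<close>.\<close>

lemma bounded_rescaling_speed:
  fixes v r \<alpha> \<beta> :: real
  assumes v: "v > 0" and r: "0 < r" "r \<le> 1 - \<alpha>" "r \<le> \<beta> - 1"
  shows "r / 4 \<le> r * v powr (r - 1) / (1 + v powr r)\<^sup>2 * (v powr \<alpha> + v powr \<beta>)"
proof -
  define D where "D = (1 + v powr r)\<^sup>2"
  have D: "D > 0"
    unfolding D_def by (intro zero_less_power add_pos_nonneg) auto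
  have "D \<le> 4 * (v powr (r - 1) * (v powr \<alpha> + v powr \<beta>))"
  proof (cases "v \<le> 1")
    case True
    have "v powr r \<le> 1"
      using True v r by (intro powr_le1) auto
    then have "D \<le> 2\<^sup>2"
      unfolding D_def by (intro power_mono) auto
    moreover have "1 \<le> v powr (r - 1 + \<alpha>)"
      using powr_mono'[of "r - 1 + \<alpha>" 0 v] True v r by simp
    then have "1 \<le> v powr (r - 1) * v powr \<alpha>"
      by (simp add: powr_add)
    then have "1 \<le> v powr (r - 1) * (v powr \<alpha> + v powr \<beta>)"
      by (simp add: distrib_left add_increasing2)
    ultimately show ?thesis by simp
  next
    case False
    have "1 \<le> v powr r"
      using False r by (intro ge_one_powr_ge_zero) auto
    then have "D \<le> (2 * v powr r)\<^sup>2"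
      unfolding D_def by (intro power_mono) auto
    also have "\<dots> = 4 * v powr (2 * r)"
      using v by (simp add: power_mult_distrib powr_power mult.commute)
    also have "v powr (2 * r) \<le> v powr (r - 1 + \<beta>)"
      using False r by (intro powr_mono) auto
    also have "\<dots> \<le> v powr (r - 1) * (v powr \<alpha> + v powr \<beta>)"
      by (simp add: powr_add distrib_left)
    finally show ?thesis by simp
  qed
  then have "r * D \<le> r * (4 * (v powr (r - 1) * (v powr \<alpha> + v powr \<beta>)))"
    using r by (intro mult_left_mono) auto
  then show ?thesis
    unfolding D_def[symmetric] using D by (simp add: field_simps)
qed

text \<open>The vanishing time depends on the exponents and coefficients of the differential inequality
  alone, since the rescaled quantity \<open>V\<^bsup>r\<^esup> / (1 + V\<^bsup>r\<^esup>)\<close> starts below \<open>1\<close> for every value of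
  \<open>V 0\<close>.\<close>

lemma fixed_time_vanishing:
  fixes V V' :: "real \<Rightarrow> real" and A B \<alpha> \<beta> :: real
  defines "r \<equiv> min (1 - \<alpha>) (\<beta> - 1)"
  assumes deriv: "\<And>t. t \<ge> 0 \<Longrightarrow> (V has_real_derivative V' t) (at t within {0..})"
    and nonneg: "\<And>t. t \<ge> 0 \<Longrightarrow> V t \<ge> 0"
    and decay: "\<And>t. t \<ge> 0 \<Longrightarrow> V' t \<le> - A * V t powr \<alpha> - B * V t powr \<beta>"
    and AB: "A > 0" "B > 0" and exponents: "\<alpha> < 1" "1 < \<beta>"
    and t: "t \<ge> 4 / (r * min A B)"
  shows "V t = 0"
proof (rule ccontr)
  assume "V t \<noteq> 0"
  have r: "0 < r" "r \<le> 1 - \<alpha>" "r \<le> \<beta> - 1"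
    using exponents by (auto simp: r_def)
  define m where "m = min A B"
  have m: "m > 0" "m \<le> A" "m \<le> B" using AB by (auto simp: m_def)
  have "4 / (r * m) > 0" using r m by simp
  with t have "t > 0" unfolding m_def[symmetric] by linarith
  with nonneg[of t] \<open>V t \<noteq> 0\<close> have Vt: "V t > 0" by simp

  have speed: "m * (V s powr \<alpha> + V s powr \<beta>) \<le> - V' s" if "s \<ge> 0" for s
  proof -
    have "m * V s powr \<alpha> \<le> A * V s powr \<alpha>" "m * V s powr \<beta> \<le> B * V s powr \<beta>"
      using m by (auto intro: mult_right_mono)
    with decay[OF that] show ?thesis by (simp add: distrib_left)
  qed

  \<comment> \<open>\<open>V\<close> is nonincreasing, so positivity at \<open>t\<close> propagates back to all earlier times, where the
    rescaling is differentiable.\<close>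
  have pos: "V s > 0" if s: "0 \<le> s" "s \<le> t" for s
  proof (cases "s = t")
    case True
    then show ?thesis using Vt by simp
  next
    case False
    with s have "s < t" by simp
    obtain u where u: "u \<in> {s<..<t}" "V t - V s = V' u * (t - s)"
      using mvt_simple[OF \<open>s < t\<close>, of V "\<lambda>u. (*) (V' u)"] s
        has_field_derivative_subset[OF deriv, of _ "{s..t}"]
      by (auto simp: has_field_derivative_def)
    have "0 \<le> m * (V u powr \<alpha> + V u powr \<beta>)" using m by simp
    also have "\<dots> \<le> - V' u" using speed[of u] u s by simp
    finally have "V' u * (t - s) \<le> 0"
      using \<open>s < t\<close> by (simp add: mult_le_0_iff)
    with u Vt show ?thesis by simp
  qed

  define \<psi> where "\<psi> v = v powr r / (1 + v powr r)" for v :: real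
  define \<psi>' where "\<psi>' v = r * v powr (r - 1) / (1 + v powr r)\<^sup>2" for v :: real
  have \<psi>_deriv: "(\<psi> has_real_derivative \<psi>' v) (at v)" if "v > 0" for v
  proof -
    have "1 + v powr r \<noteq> 0"
      using powr_ge_zero[of v r] by linarith
    with that show ?thesis
      unfolding \<psi>_def[abs_def] \<psi>'_def
      by (auto intro!: derivative_eq_intros simp: power2_eq_square field_simps)
  qed
  have "((\<lambda>s. \<psi> (V s)) has_real_derivative \<psi>' (V s) * V' s) (at s within {0..t})"
    if "0 \<le> s" "s \<le> t" for s
    using DERIV_chain2[where f = \<psi> and g = V and x = s and s = "{0..t}", OF \<psi>_deriv[OF pos[OF that]]]
      has_field_derivative_subset[OF deriv[OF that(1)], of "{0..t}"]
    by auto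
  then obtain u where u: "0 < u" "u < t" "\<psi> (V t) - \<psi> (V 0) = \<psi>' (V u) * V' u * t"
    using mvt_simple[OF \<open>t > 0\<close>, of "\<lambda>s. \<psi> (V s)" "\<lambda>s. (*) (\<psi>' (V s) * V' s)"]
    by (auto simp: has_field_derivative_def)
  have "m * (r / 4) \<le> m * (\<psi>' (V u) * (V u powr \<alpha> + V u powr \<beta>))"
    using bounded_rescaling_speed[OF pos[of u] r] u m
    unfolding \<psi>'_def by (intro mult_left_mono) auto
  also have "\<dots> = \<psi>' (V u) * (m * (V u powr \<alpha> + V u powr \<beta>))"
    by simp
  also have "\<dots> \<le> \<psi>' (V u) * - V' u"
    using speed[of u] u r by (intro mult_left_mono) (auto simp: \<psi>'_def)
  finally have "m * (r / 4) * t \<le> \<psi>' (V u) * - V' u * t"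
    using \<open>t > 0\<close> by (intro mult_right_mono) auto
  moreover have "m * (r / 4) * t \<ge> 1"
    using t r m unfolding m_def[symmetric] by (simp add: field_simps)
  moreover have "\<psi> (V 0) < 1" "0 \<le> \<psi> (V t)"
    by (auto simp: \<psi>_def add_pos_nonneg field_simps)
  ultimately show False using u by simp
qed

text \<open>The flow direction is built from rescaled copies of \<open>-grad f x\<close>; pairing it with the gradient
  adds \<open>2\<close> to each exponent, and \<open>2 - (p - 2) / (p - 1) = p / (p - 1)\<close>. The identity survives at
  critical points because \<^term>\<open>0 powr q = (0::real)\<close>.\<close>

lemma flow_rhs_inner_grad:
  fixes f :: "'a::real_inner \<Rightarrow> real"
  assumes "p1 \<noteq> 1" "p2 \<noteq> 1"
  shows "inner (flow_rhs c1 c2 p1 p2 f x) (grad f x) =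
    - c1 * norm (grad f x) powr (p1 / (p1 - 1)) - c2 * norm (grad f x) powr (p2 / (p2 - 1))"
proof (cases "grad f x = 0")
  case True
  then show ?thesis by simp
next
  case False
  define g where "g = norm (grad f x)"
  have g: "g > 0" using False by (simp add: g_def)
  have conjugate: "inverse (g powr ((p - 2) / (p - 1))) * g\<^sup>2 = g powr (p / (p - 1))"
    if "p \<noteq> 1" for p
  proof -
    have "p / (p - 1) = 2 - (p - 2) / (p - 1)" using that by (simp add: field_simps)
    then have "g powr (p / (p - 1)) = g powr 2 / g powr ((p - 2) / (p - 1))"
      by (simp add: powr_diff)
    then show ?thesis using g by (simp add: powr_numeral divide_inverse mult.commute)
  qed
  have "inner (flow_rhs c1 c2 p1 p2 f x) (grad f x) =
      - c1 * (inverse (g powr ((p1 - 2) / (p1 - 1))) * g\<^sup>2)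
      - c2 * (inverse (g powr ((p2 - 2) / (p2 - 1))) * g\<^sup>2)"
    using False by (simp add: flow_rhs_def inner_diff_left g_def power2_norm_eq_inner)
  also have "\<dots> = - c1 * g powr (p1 / (p1 - 1)) - c2 * g powr (p2 / (p2 - 1))"
    by (simp only: conjugate[OF assms(1)] conjugate[OF assms(2)])
  finally show ?thesis by (simp add: g_def)
qed

lemma gradient_dominance_powr:
  fixes g v \<mu> q :: real
  assumes "1/2 * g\<^sup>2 \<ge> \<mu> * v" "g \<ge> 0" "v \<ge> 0" "\<mu> > 0" "q \<ge> 0"
  shows "(2 * \<mu>) powr (q / 2) * v powr (q / 2) \<le> g powr q"
proof -
  have "(2 * \<mu>) powr (q / 2) * v powr (q / 2) = (2 * \<mu> * v) powr (q / 2)"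
    using assms by (simp add: powr_mult)
  also have "\<dots> \<le> (g\<^sup>2) powr (q / 2)"
    using assms by (intro powr_mono2) auto
  also have "\<dots> = g powr q"
    using assms by (cases "g = 0") (simp_all flip: powr_numeral add: powr_powr)
  finally show ?thesis .
qed

lemma trajectory_value_derivative:
  fixes f :: "'a::real_inner \<Rightarrow> real"
  assumes "\<exists>D. GDERIV f (x t) :> D" "is_trajectory F x" "t \<ge> 0"
  shows "((\<lambda>t. f (x t)) has_real_derivative inner (F (x t)) (grad f (x t))) (at t within {0..})"
proof -
  from assms(1) have f: "(f has_derivative (\<lambda>h. inner h (grad f (x t)))) (at (x t))"
    using grad_eqI unfolding gderiv_def[symmetric] by metis
  have x: "(x has_derivative (\<lambda>h. h *\<^sub>R F (x t))) (at t within {0..})"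
    using assms(2,3) by (auto simp: is_trajectory_def has_vector_derivative_def)
  have "((\<lambda>t. f (x t)) has_derivative (\<lambda>h. inner (h *\<^sub>R F (x t)) (grad f (x t))))
      (at t within {0..})"
    by (rule has_derivative_compose[OF x f])
  then show ?thesis
    by (simp add: has_field_derivative_def mult.commute[of _ "inner _ _"])
qed

theorem theorem2:
  fixes f :: "real ^ 'n \<Rightarrow> real"
    and fstar \<mu> c1 c2 p1 p2 :: real
    and xstar :: "real ^ 'n"
  assumes "C11_loc f"
    and "\<And>x. fstar \<le> f x"
    and "f xstar = fstar"
    and "\<And>x. f x = fstar \<Longrightarrow> x = xstar"
    and "\<mu> > 0"
    and "\<And>x. 1/2 * (norm (grad f x))\<^sup>2 \<ge> \<mu> * (f x - fstar)"
    and "c1 > 0" and "c2 > 0"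
    and "p1 > 2" and "1 < p2" and "p2 < 2"
  shows "\<exists>T\<ge>0. \<forall>x. is_trajectory (flow_rhs c1 c2 p1 p2 f) x \<longrightarrow>
           (\<forall>t\<ge>T. x t = xstar)"
proof -
  define q1 q2 where "q1 = p1 / (p1 - 1)" and "q2 = p2 / (p2 - 1)"
  have q: "0 \<le> q1" "q1 / 2 < 1" "0 \<le> q2" "1 < q2 / 2"
    using assms(9-11) by (auto simp: q1_def q2_def field_simps)
  define A B where "A = c1 * (2 * \<mu>) powr (q1 / 2)" and "B = c2 * (2 * \<mu>) powr (q2 / 2)"
  have AB: "A > 0" "B > 0" using assms(5,7,8) by (auto simp: A_def B_def)
  define T where "T = 4 / (min (1 - q1 / 2) (q2 / 2 - 1) * min A B)"
  have "T \<ge> 0" using q AB by (simp add: T_def)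
  moreover have "x t = xstar"
    if traj: "is_trajectory (flow_rhs c1 c2 p1 p2 f) x" and "t \<ge> T" for x t
  proof -
    define V where "V s = f (x s) - fstar" for s
    define V' where "V' s = inner (flow_rhs c1 c2 p1 p2 f (x s)) (grad f (x s))" for s
    have "V t = 0"
    proof (rule fixed_time_vanishing[where V = V and V' = V' and A = A and B = B and
          \<alpha> = "q1 / 2" and \<beta> = "q2 / 2"])
      show "(V has_real_derivative V' s) (at s within {0..})" if "s \<ge> 0" for s
      proof -
        have "\<exists>D. GDERIV f (x s) :> D" using assms(1) by (simp add: C11_loc_def)
        from trajectory_value_derivative[OF this traj that] show ?thesis
          unfolding V_def[abs_def] V'_def by (auto intro!: derivative_eq_intros)
      qed
      show V: "V s \<ge> 0" for s using assms(2) by (simp add: V_def)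
      show "V' s \<le> - A * V s powr (q1 / 2) - B * V s powr (q2 / 2)" for s
      proof -
        let ?g = "norm (grad f (x s))"
        have dominance: "(2 * \<mu>) powr (q / 2) * V s powr (q / 2) \<le> ?g powr q" if "q \<ge> 0" for q
          using gradient_dominance_powr[of \<mu> "V s" ?g q] assms(5) assms(6)[of "x s"] V[of s] that
          by (simp add: V_def)
        have "A * V s powr (q1 / 2) \<le> c1 * ?g powr q1" "B * V s powr (q2 / 2) \<le> c2 * ?g powr q2"
          using mult_left_mono[OF dominance[OF q(1)], of c1]
            mult_left_mono[OF dominance[OF q(3)], of c2] assms(7,8)
          by (simp_all add: A_def B_def mult.assoc)
        moreover have "V' s = - c1 * ?g powr q1 - c2 * ?g powr q2"
          using flow_rhs_inner_grad[of p1 p2 c1 c2 f "x s"] assms(9,10)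
          by (simp add: V'_def q1_def q2_def)
        ultimately show ?thesis by simp
      qed
    qed (use AB q \<open>t \<ge> T\<close> in \<open>auto simp: T_def\<close>)
    then show ?thesis using assms(4) by (simp add: V_def)
  qed
  ultimately show ?thesis by blast
qed

end
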